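(* Let $n\ge3$, let $l_1,\ldots,l_L$ be positive integers, let $p=p_1\otimes\cdots\otimes p_L\in B_{l_1}\otimes\cdots\otimes B_{l_L}$ and put $p_{[k]}=p_1\otimes\cdots\otimes p_k$. For $1\le k\le L$ set $\delta\rho_g=\rho_g(p_{[k]})-\rho_g(p_{[k-1]})$, with the convention $\rho_g(p_{[0]})=0$. Then the local state $p_k=(\zeta_1,\ldots,\zeta_n,\overline\zeta_n,\ldots,\overline\zeta_1)\in B_{l_k}$ is reproduced from the counting functions by $$\begin{aligned} \zeta_1&=l_k-\delta\rho_{v_0}+\delta\rho_{w_1-v_1},\\ \zeta_a&=\delta\rho_{w_a-v_a}-\delta\rho_{w_{a-1}-v_{a-1}}\quad(2\le a\le n-2),\\ \zeta_{n-1}&=\min(\delta\rho_{v_{n-1}},\delta\rho_{v^\ast_{n-1}})-\delta\rho_{w_{n-2}-v_{n-2}},\\ \zeta_n&=\max(\delta\rho_{v_{n-1}}-\delta\rho_{v^\ast_{n-1}},0),\\ \overline\zeta_n&=\max(\delta\rho_{v^\ast_{n-1}}-\delta\rho_{v_{n-1}},0),\\ \overline\zeta_{n-1}&=-\max(\delta\rho_{v_{n-1}},\delta\rho_{v^\ast_{n-1}})+\delta\rho_{v_{n-2}},\\ \overline\zeta_a&=\delta\rho_{v_{a-1}}-\delta\rho_{v_a}\quad(1\le a\le n-2). \end{aligned}$$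
   Context: **Crystals (as sets).** $n\ge3$. For $l\ge1$, $B_l=\{\zeta=(\zeta_1,\ldots,\zeta_n,\overline\zeta_n,\ldots,\overline\zeta_1)\in\mathbb Z_{\ge0}^{2n}\mid \sum_{i=1}^n(\zeta_i+\overline\zeta_i)=l,\ \zeta_n\overline\zeta_n=0\}$ (the crystal of the $l$-fold symmetric tensor representation of $U_q(D_n^{(1)})$). $u_l=(l,0,\ldots,0)\in B_l$. $B_l$ is identified with $B'_l=\{x=(x_1,\ldots,x_n,\overline x_{n-1},\ldots,\overline x_1)\in\mathbb Z^{2n-1}\mid x_i,\overline x_i\ge0\ (1\le i\le n-1),\ x_n\ge-\min(x_{n-1},\overline x_{n-1}),\ \sum_{i=1}^{n-1}(x_i+\overline x_i)+x_n=l\}$ by $x_i=\zeta_i,\ \overline x_i=\overline\zeta_i$ $(i\le n-2)$, $x_{n-1}=\zeta_{n-1}+\overline\zeta_n$, $x_n=\zeta_n-\overline\zeta_n$, $\overline x_{n-1}=\overline\zeta_{n-1}+\overline\zeta_n$ (inverse: $\zeta_n=\max(0,x_n)$, $\overline\zeta_n=\max(0,-x_n)$, $\zeta_{n-1}=x_{n-1}+\min(0,x_n)$, $\overline\zeta_{n-1}=\overline x_{n-1}+\min(0,x_n)$). Write $\ell(x)=\ell(\zeta)=l$. Elements of $B_{l_1}\otimes\cdots\otimes B_{l_L}$ are tuples, written with $\otimes$. **Piecewise linear functions.** Involutions on a single element: $\sigma_1$ swaps $x_1\leftrightarrow\overline x_1$; $\ast$ swaps $x_i\leftrightarrow\overline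 x_i$ for $1\le i\le n-1$; other coordinates are unchanged. On pairs, $(x,y)^{\sigma_1}=(x^{\sigma_1},y^{\sigma_1})$ and $(x,y)^\ast=(y^\ast,x^\ast)$; for a function $f(x,y)$ put $f^{\sigma_1}(x,y)=f((x,y)^{\sigma_1})$, $f^\ast(x,y)=f((x,y)^\ast)$. For $x\in B'_l,\ y\in B'_m$, $0\le i\le n-1$: $V_i=\max(\{\theta_{i,j},\theta'_{i,j}\mid1\le j\le n-2\}\cup\{\eta_{i,j},\eta'_{i,j}\mid1\le j\le n\})$, with - $\theta_{i,j}=\ell(x)+\sum_{k=j+1}^i(\overline y_k-\overline x_k)$ for $1\le j\le i$; $\theta_{i,j}=\ell(y)+\sum_{k=i+1}^j(\overline x_k-\overline y_k)$ for $i+1\le j\le n-2$; - $\theta'_{i,j}=\ell(x)+\sum_{k=1}^i(\overline y_k-\overline x_k)+\sum_{k=1}^j(y_k-x_k)$ for $1\le j\le n-2$; - $\eta_{i,j}=\ell(x)+\sum_{k=j+1}^i(\overline y_k-\overline x_k)+\overline y_j-x_j$ for $1\le j\le i$; $\eta_{i,j}=\ell(y)+\sum_{k=i+1}^j(\overline x_k-\overline y_k)+\overline y_j-x_j$ for $i+1\le j\le n-1$; $\eta_{i,n}=\ell(y)+\sum_{k=i+1}^{n-1}(\overline x_k-\overline y_k)+x_n$; - $\eta'_{i,j}=\ell(x)+\sum_{k=1}^i(\overline y_k-\overline x_k)+\sum_{k=1}^j(y_k-x_k)+x_j-\overline y_j$ for $1\le j\le n-1$; $\eta'_{i,n}=\ell(x)+\delta_{i,n-1}(\ell(x)-\ell(y))+\sum_{k=1}^i(\overline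 y_k-\overline x_k)+\sum_{k=1}^{n-1}(y_k-x_k)-x_n$. $W_0=2V_0$, $W_1=V_0+V_0^{\sigma_1}$, $W_{n-1}=V_{n-1}+V_{n-1}^\ast$, and $W_i=\max(V_i+V_{i-1}^\ast-y_i,\ V_{i-1}+V_i^\ast-\overline x_i)+\min(x_i,\overline y_i)$ for $2\le i\le n-2$. **Combinatorial $R$.** $R:B_l\otimes B_m\to B_m\otimes B_l$ is the unique isomorphism of $U_q(D_n^{(1)})$-crystals; explicitly (known result) $R(x\otimes y)=y'\otimes x'$ with, for $1\le i\le n-1$, $x'_i=x_i+V_{i-1}^\ast-V_i^\ast$, $\overline x'_i=\overline x_i+V^\ast_{i-1}+W_i-V^\ast_i-W_{i-1}$, $y'_i=y_i+V_{i-1}+W_i-V_i-W_{i-1}$, $\overline y'_i=\overline y_i+V_{i-1}-V_i$, and $x'_n=x_n+V^\ast_{n-1}-V_{n-1}$, $y'_n=y_n+V_{n-1}-V^\ast_{n-1}$. $\simeq$ denotes correspondence under compositions of $R$'s acting on adjacent factors. **Time evolution and counting functions.** For a state $p=p_1\otimes\cdots\otimes p_L$ (any $L\geq 1$), $T_l(p)=p'_1\otimes\cdots\otimes p'_L$ is defined by $u_l\otimes p_1\otimes\cdots\otimes p_L\simeq p'_1\otimes\cdots\otimes p'_L\otimes\xi$ with $\xi\in B_l$ (carrying the left factor to the right by $R$); $T_l(p)$ stabilizes for large $l$, and the limit is $T_\infty(p)$. Write $T_\infty^t(p)=p_1^t\otimes\cdots\otimes p_L^t$. For $\zeta\in B_l$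 set $\mathfrak a(\zeta)=\zeta_2+\cdots+\zeta_n+\overline\zeta_n+\cdots+\overline\zeta_2+2\overline\zeta_1$; $\gamma_{v_a}(\zeta)=\zeta_2+\cdots+\zeta_n+\overline\zeta_n+\cdots+\overline\zeta_{a+1}+\overline\zeta_1$ $(0\le a\le n-2)$ (so $\gamma_{v_0}=\mathfrak a$); $\gamma_{v_{n-1}}(\zeta)=\zeta_2+\cdots+\zeta_{n-1}+\zeta_n+\overline\zeta_1$; $\gamma_{v^\ast_{n-1}}(\zeta)=\zeta_2+\cdots+\zeta_{n-1}+\overline\zeta_n+\overline\zeta_1$; $\gamma_{w_a-v_a}(\zeta)=\zeta_2+\cdots+\zeta_a+\overline\zeta_1$ $(1\le a\le n-2)$. (Here $v_a$, $v^\ast_{n-1}$, $w_a-v_a$ serve only as labels.) The counting function of a state is $\rho_g(p)=\sum_{j=1}^L\gamma_g(p_j)+\sum_{t\ge1}\sum_{j=1}^L\mathfrak a(p^t_j)$; the sum is finite because $p^t_j=u_{l_j}$ for all $j$ when $t\ge L$. $\rho_g(p_{[k]})$ is this function for the state $p_{[k]}$ with $k$ tensor factors. *)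

theory Defs
  imports Complex_Main
begin

text \<open>
  A vector \<open>(z_1, \<dots>, z_n, zbar_n, \<dots>, zbar_1)\<close> is stored as two functions on indices
  \<open>1, \<dots>, n\<close>; both are \<open>0\<close> at all other indices, so that equality of stored vectors is equality of
  tuples. In the \<open>B'\<close> coordinates there is no \<open>xbar_n\<close>, and \<open>cbar x n = 0\<close>.
\<close>

datatype vec = Vec (co: "nat \<Rightarrow> int") (cbar: "nat \<Rightarrow> int")

definition B :: "nat \<Rightarrow> nat \<Rightarrow> vec set" where
  "B n l = {\<zeta>. (\<forall>i\<in>{1..n}. co \<zeta> i \<ge> 0 \<and> cbar \<zeta> i \<ge> 0)
              \<and> (\<forall>i. i \<notin> {1..n} \<longrightarrow> co \<zeta> i = 0 \<and> cbar \<zeta> i = 0)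
              \<and> (\<Sum>i=1..n. co \<zeta> i + cbar \<zeta> i) = int l
              \<and> co \<zeta> n * cbar \<zeta> n = 0}"

definition u :: "nat \<Rightarrow> vec" where
  "u l = Vec (\<lambda>i. if i = 1 then int l else 0) (\<lambda>i. 0)"

definition B' :: "nat \<Rightarrow> nat \<Rightarrow> vec set" where
  "B' n l = {x. (\<forall>i\<in>{1..n-1}. co x i \<ge> 0 \<and> cbar x i \<ge> 0)
              \<and> co x n \<ge> - min (co x (n-1)) (cbar x (n-1))
              \<and> (\<forall>i. i \<notin> {1..n} \<longrightarrow> co x i = 0) \<and> (\<forall>i. i \<notin> {1..n-1} \<longrightarrow> cbar x i = 0)
              \<and> (\<Sum>i=1..n-1. co x i + cbar x i) + co x n = int l}"

definition to_B' :: "nat \<Rightarrow> vec \<Rightarrow> vec" where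
  "to_B' n \<zeta> = Vec
     (\<lambda>i. if i = n - 1 then co \<zeta> (n-1) + cbar \<zeta> n
          else if i = n then co \<zeta> n - cbar \<zeta> n
          else co \<zeta> i)
     (\<lambda>i. if i = n - 1 then cbar \<zeta> (n-1) + cbar \<zeta> n
          else if i = n then 0
          else cbar \<zeta> i)"

definition of_B' :: "nat \<Rightarrow> vec \<Rightarrow> vec" where
  "of_B' n x = Vec
     (\<lambda>i. if i = n - 1 then co x (n-1) + min 0 (co x n)
          else if i = n then max 0 (co x n)
          else co x i)
     (\<lambda>i. if i = n - 1 then cbar x (n-1) + min 0 (co x n)
          else if i = n then max 0 (- co x n)
          else cbar x i)"

text \<open>The value of \<open>ell n\<close> at an element of \<open>B' n l\<close> is \<open>l\<close>.\<close>

definition ell :: "nat \<Rightarrow> vec \<Rightarrow> int" where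
  "ell n x = (\<Sum>i=1..n-1. co x i + cbar x i) + co x n"

definition sigma1 :: "vec \<Rightarrow> vec" where
  "sigma1 x = Vec ((co x)(1 := cbar x 1)) ((cbar x)(1 := co x 1))"

definition star :: "nat \<Rightarrow> vec \<Rightarrow> vec" where
  "star n x = Vec
     (\<lambda>i. if 1 \<le> i \<and> i \<le> n - 1 then cbar x i else co x i)
     (\<lambda>i. if 1 \<le> i \<and> i \<le> n - 1 then co x i else cbar x i)"

definition theta :: "nat \<Rightarrow> nat \<Rightarrow> nat \<Rightarrow> vec \<Rightarrow> vec \<Rightarrow> int" where
  "theta n i j x y =
     (if j \<le> i then ell n x + (\<Sum>k=j+1..i. cbar y k - cbar x k)
      else ell n y + (\<Sum>k=i+1..j. cbar x k - cbar y k))"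

definition theta' :: "nat \<Rightarrow> nat \<Rightarrow> nat \<Rightarrow> vec \<Rightarrow> vec \<Rightarrow> int" where
  "theta' n i j x y =
     ell n x + (\<Sum>k=1..i. cbar y k - cbar x k) + (\<Sum>k=1..j. co y k - co x k)"

definition eta :: "nat \<Rightarrow> nat \<Rightarrow> nat \<Rightarrow> vec \<Rightarrow> vec \<Rightarrow> int" where
  "eta n i j x y =
     (if j = n then ell n y + (\<Sum>k=i+1..n-1. cbar x k - cbar y k) + co x n
      else if j \<le> i then ell n x + (\<Sum>k=j+1..i. cbar y k - cbar x k) + cbar y j - co x j
      else ell n y + (\<Sum>k=i+1..j. cbar x k - cbar y k) + cbar y j - co x j)"

definition eta' :: "nat \<Rightarrow> nat \<Rightarrow> nat \<Rightarrow> vec \<Rightarrow> vec \<Rightarrow> int" where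
  "eta' n i j x y =
     (if j = n then
        ell n x + (if i = n - 1 then ell n x - ell n y else 0)
          + (\<Sum>k=1..i. cbar y k - cbar x k) + (\<Sum>k=1..n-1. co y k - co x k) - co x n
      else
        ell n x + (\<Sum>k=1..i. cbar y k - cbar x k) + (\<Sum>k=1..j. co y k - co x k)
          + co x j - cbar y j)"

definition V :: "nat \<Rightarrow> nat \<Rightarrow> vec \<Rightarrow> vec \<Rightarrow> int" where
  "V n i x y = Max
     ((\<lambda>j. theta n i j x y) ` {1..n-2} \<union> (\<lambda>j. theta' n i j x y) ` {1..n-2}
      \<union> (\<lambda>j. eta n i j x y) ` {1..n} \<union> (\<lambda>j. eta' n i j x y) ` {1..n})"

definition V_sigma1 :: "nat \<Rightarrow> nat \<Rightarrow> vec \<Rightarrow> vec \<Rightarrow> int" where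
  "V_sigma1 n i x y = V n i (sigma1 x) (sigma1 y)"

text \<open>The involution \<open>*\<close> also exchanges the two members of a pair.\<close>

definition V_star :: "nat \<Rightarrow> nat \<Rightarrow> vec \<Rightarrow> vec \<Rightarrow> int" where
  "V_star n i x y = V n i (star n y) (star n x)"

definition W :: "nat \<Rightarrow> nat \<Rightarrow> vec \<Rightarrow> vec \<Rightarrow> int" where
  "W n i x y =
     (if i = 0 then 2 * V n 0 x y
      else if i = 1 then V n 0 x y + V_sigma1 n 0 x y
      else if i = n - 1 then V n (n-1) x y + V_star n (n-1) x y
      else max (V n i x y + V_star n (i-1) x y - co y i)
               (V n (i-1) x y + V_star n i x y - cbar x i)
           + min (co x i) (cbar y i))"

text \<open>
  \<open>R'\<close> is the combinatorial R in the \<open>B'\<close> coordinates, given by its known explicit piecewise linear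
  formula. The image \<open>y' \<otimes> x'\<close> of \<open>x \<otimes> y\<close> is the pair \<open>(y', x')\<close>.
\<close>

definition R' :: "nat \<Rightarrow> vec \<Rightarrow> vec \<Rightarrow> vec \<times> vec" where
  "R' n x y =
     (Vec
        (\<lambda>i. if 1 \<le> i \<and> i \<le> n - 1
             then co y i + V n (i-1) x y + W n i x y - V n i x y - W n (i-1) x y
             else if i = n then co y n + V n (n-1) x y - V_star n (n-1) x y
             else 0)
        (\<lambda>i. if 1 \<le> i \<and> i \<le> n - 1
             then cbar y i + V n (i-1) x y - V n i x y
             else 0),
      Vec
        (\<lambda>i. if 1 \<le> i \<and> i \<le> n - 1
             then co x i + V_star n (i-1) x y - V_star n i x y
             else if i = n then co x n + V_star n (n-1) x y - V n (n-1) x y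
             else 0)
        (\<lambda>i. if 1 \<le> i \<and> i \<le> n - 1
             then cbar x i + V_star n (i-1) x y + W n i x y - V_star n i x y - W n (i-1) x y
             else 0))"

definition R :: "nat \<Rightarrow> vec \<Rightarrow> vec \<Rightarrow> vec \<times> vec" where
  "R n \<zeta> \<omega> = map_prod (of_B' n) (of_B' n) (R' n (to_B' n \<zeta>) (to_B' n \<omega>))"

text \<open>
  \<open>carry n c p = (p', \<xi>)\<close> means \<open>c \<otimes> p \<simeq> p' \<otimes> \<xi>\<close>, the factor \<open>c\<close> being moved to the right through the
  tensor factors listed in \<open>p\<close>.
\<close>

fun carry :: "nat \<Rightarrow> vec \<Rightarrow> vec list \<Rightarrow> vec list \<times> vec" where
  "carry n c [] = ([], c)"
| "carry n c (q # qs) =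
     (let (q', c') = R n c q; (qs', \<xi>) = carry n c' qs in (q' # qs', \<xi>))"

definition T :: "nat \<Rightarrow> nat \<Rightarrow> vec list \<Rightarrow> vec list" where
  "T n l p = fst (carry n (u l) p)"

definition T_inf :: "nat \<Rightarrow> vec list \<Rightarrow> vec list" where
  "T_inf n p = (THE q. \<forall>\<^sub>F l in sequentially. T n l p = q)"

definition afun :: "nat \<Rightarrow> vec \<Rightarrow> int" where
  "afun n \<zeta> = (\<Sum>i=2..n. co \<zeta> i) + (\<Sum>i=2..n. cbar \<zeta> i) + 2 * cbar \<zeta> 1"

text \<open>
  \<open>Lab_v a\<close> stands for \<open>v_a\<close> with \<open>0 \<le> a \<le> n-1\<close>, \<open>Lab_vstar\<close> for \<open>v^*_{n-1}\<close>, and \<open>Lab_wv a\<close> for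
  \<open>w_a - v_a\<close> with \<open>1 \<le> a \<le> n-2\<close>.
\<close>

datatype lab = Lab_v nat | Lab_vstar | Lab_wv nat

fun gamma :: "nat \<Rightarrow> lab \<Rightarrow> vec \<Rightarrow> int" where
  "gamma n (Lab_v a) \<zeta> =
     (if a = n - 1 then (\<Sum>i=2..n-1. co \<zeta> i) + co \<zeta> n + cbar \<zeta> 1
      else (\<Sum>i=2..n. co \<zeta> i) + (\<Sum>i=a+1..n. cbar \<zeta> i) + cbar \<zeta> 1)"
| "gamma n Lab_vstar \<zeta> = (\<Sum>i=2..n-1. co \<zeta> i) + cbar \<zeta> n + cbar \<zeta> 1"
| "gamma n (Lab_wv a) \<zeta> = (\<Sum>i=2..a. co \<zeta> i) + cbar \<zeta> 1"

text \<open>The index \<open>t\<close> of the infinite sum is shifted by one: the times are \<open>1, 2, 3, \<dots>\<close>.\<close>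

definition rho :: "nat \<Rightarrow> lab \<Rightarrow> vec list \<Rightarrow> int" where
  "rho n g p = (\<Sum>j<length p. gamma n g (p ! j))
             + (\<Sum>t. \<Sum>j<length p. afun n (((T_inf n ^^ Suc t) p) ! j))"

lemma rho_Nil: "rho n g [] = 0"
  by (simp add: rho_def)

definition drho :: "nat \<Rightarrow> vec list \<Rightarrow> nat \<Rightarrow> lab \<Rightarrow> int" where
  "drho n p k g = rho n g (take k p) - rho n g (take (k - 1) p)"

end

theory Submission
  imports Defs
begin

text \<open>
  The double sum over the times \<open>t \<ge> 1\<close> does not involve the label \<open>g\<close>. Hence \<open>\<delta>\<rho>\<^sub>g\<close> and
  \<open>\<gamma>\<^sub>g(p\<^sub>k)\<close> differ by an amount that is the same for all labels, and every right-hand side is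
  invariant under a common shift of the \<open>\<delta>\<rho>\<^sub>g\<close>. With \<open>\<gamma>\<^sub>g(p\<^sub>k)\<close> in place of \<open>\<delta>\<rho>\<^sub>g\<close> the formulas
  follow from \<open>\<ell>(p\<^sub>k) = l\<^sub>k\<close> and from the vanishing of one of \<open>\<zeta>\<^sub>n\<close>, \<open>\<zeta>bar\<^sub>n\<close>.
\<close>

lemma drho_eq_gamma_plus_const:
  assumes "1 \<le> k" and "k \<le> length p"
  obtains d where "\<And>g. drho n p k g = gamma n g (p ! (k - 1)) + d"
proof -
  define S where
    "S q = (\<Sum>t. \<Sum>j<length q. afun n (((T_inf n ^^ Suc t) q) ! j))" for q :: "vec list"
  obtain m where k: "k = Suc m"
    using assms(1) by (cases k) auto
  have rho_take: "rho n g (take i p) = (\<Sum>j<i. gamma n g (p ! j)) + S (take i p)"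
    if "i \<le> length p" for g i
    using that by (simp add: rho_def S_def min_absorb2)
  \<comment> \<open>With \<open>k = Suc m\<close>, the sum over \<open>j < k\<close> splits off
    \<open>p ! m\<close>; the \<open>S\<close> terms are free of \<open>g\<close>.\<close>
  have "drho n p k g = gamma n g (p ! (k - 1)) + (S (take k p) - S (take (k - 1) p))" for g
    using assms(2) by (simp add: drho_def rho_take k)
  then show thesis
    by (rule that)
qed

lemma B_cases:
  assumes "\<zeta> \<in> B n l" and "1 \<le> n"
  obtains "co \<zeta> n = 0" "0 \<le> cbar \<zeta> n" | "cbar \<zeta> n = 0" "0 \<le> co \<zeta> n"
  using assms by (auto simp: B_def)

lemma gamma_co:
  assumes "2 \<le> a" and "a \<le> n - 2"
  shows "co \<zeta> a = gamma n (Lab_wv a) \<zeta> - gamma n (Lab_wv (a - 1)) \<zeta>"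
  using assms by (cases a) simp_all

lemma gamma_cbar:
  assumes "1 \<le> a" and "a \<le> n - 2"
  shows "cbar \<zeta> a = gamma n (Lab_v (a - 1)) \<zeta> - gamma n (Lab_v a) \<zeta>"
proof -
  \<comment> \<open>Both labels thus avoid the special clause of \<open>gamma\<close> for
    \<open>Lab_v (n - 1)\<close>.\<close>
  have "a - 1 \<noteq> n - 1" and "a \<noteq> n - 1" and "a \<le> n"
    using assms by auto
  then show ?thesis
    using assms(1) by (simp add: sum.atLeast_Suc_atMost[of a n])
qed

text \<open>\<open>Lab_v 0\<close> counts \<open>cbar \<zeta> 1\<close> twice; adding
  \<open>Lab_wv 1\<close>, which is just \<open>cbar \<zeta> 1\<close>, corrects this.\<close>

lemma gamma_co_1:
  assumes "\<zeta> \<in> B n l" and "2 \<le> n"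
  shows "co \<zeta> 1 = int l - gamma n (Lab_v 0) \<zeta> + gamma n (Lab_wv 1) \<zeta>"
proof -
  have "int l = (\<Sum>i=1..n. co \<zeta> i) + (\<Sum>i=1..n. cbar \<zeta> i)"
    using assms(1) by (simp add: B_def sum.distrib)
  then show ?thesis
    using assms(2) by (simp add: sum.atLeast_Suc_atMost[of "Suc 0" n] numeral_2_eq_2)
qed

text \<open>Let \<open>s\<close> be the common part of \<open>v = s + co \<zeta> n\<close> and
  \<open>v' = s + cbar \<zeta> n\<close>. As one of the two entries vanishes and both are
  nonnegative, \<open>min v v' = s\<close> and
  \<open>max v v' = s + co \<zeta> n + cbar \<zeta> n\<close>.\<close>

lemma gamma_last:
  assumes "\<zeta> \<in> B n l" and "3 \<le> n"
  defines "v \<equiv> gamma n (Lab_v (n - 1)) \<zeta>" and "v' \<equiv> gamma n Lab_vstar \<zeta>"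
  shows "co \<zeta> (n - 1) = min v v' - gamma n (Lab_wv (n - 2)) \<zeta>"
    and "co \<zeta> n = max (v - v') 0"
    and "cbar \<zeta> n = max (v' - v) 0"
    and "cbar \<zeta> (n - 1) = - max v v' + gamma n (Lab_v (n - 2)) \<zeta>"
proof -
  obtain m where n: "n = Suc (Suc (Suc m))"
    using assms(2) by (metis Suc_le_D numeral_3_eq_3 Suc_le_mono)
  note defs = v_def v'_def n numeral_2_eq_2
  have c: "co \<zeta> n = 0 \<and> 0 \<le> cbar \<zeta> n \<or> cbar \<zeta> n = 0 \<and> 0 \<le> co \<zeta> n"
    using B_cases[OF assms(1)] assms(2) by auto
  then show "co \<zeta> (n - 1) = min v v' - gamma n (Lab_wv (n - 2)) \<zeta>"
    and "co \<zeta> n = max (v - v') 0"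
    and "cbar \<zeta> n = max (v' - v) 0"
    and "cbar \<zeta> (n - 1) = - max v v' + gamma n (Lab_v (n - 2)) \<zeta>"
    by (auto simp: defs)
qed

theorem theorem3p5:
  fixes n L k :: nat and l :: "nat \<Rightarrow> nat" and p :: "vec list"
  assumes "n \<ge> 3"
    and "\<And>j. 1 \<le> j \<Longrightarrow> j \<le> L \<Longrightarrow> l j \<ge> 1"
    and "length p = L"
    and "\<And>j. 1 \<le> j \<Longrightarrow> j \<le> L \<Longrightarrow> p ! (j - 1) \<in> B n (l j)"
    and "1 \<le> k" and "k \<le> L"
  shows
    "co (p ! (k-1)) 1 = int (l k) - drho n p k (Lab_v 0) + drho n p k (Lab_wv 1) \<and>
     (\<forall>a. 2 \<le> a \<and> a \<le> n - 2 \<longrightarrow>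
        co (p ! (k-1)) a = drho n p k (Lab_wv a) - drho n p k (Lab_wv (a-1))) \<and>
     co (p ! (k-1)) (n-1) =
        min (drho n p k (Lab_v (n-1))) (drho n p k Lab_vstar) - drho n p k (Lab_wv (n-2)) \<and>
     co (p ! (k-1)) n = max (drho n p k (Lab_v (n-1)) - drho n p k Lab_vstar) 0 \<and>
     cbar (p ! (k-1)) n = max (drho n p k Lab_vstar - drho n p k (Lab_v (n-1))) 0 \<and>
     cbar (p ! (k-1)) (n-1) =
        - max (drho n p k (Lab_v (n-1))) (drho n p k Lab_vstar) + drho n p k (Lab_v (n-2)) \<and>
     (\<forall>a. 1 \<le> a \<and> a \<le> n - 2 \<longrightarrow>
        cbar (p ! (k-1)) a = drho n p k (Lab_v (a-1)) - drho n p k (Lab_v a))"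
proof -
  have mem: "p ! (k - 1) \<in> B n (l k)"
    using assms by blast
  obtain d where d: "\<And>g. drho n p k g = gamma n g (p ! (k - 1)) + d"
    using drho_eq_gamma_plus_const assms by metis
  have shift: "min (x + d) (y + d) = min x y + d" "max (x + d) (y + d) = max x y + d"
    for x y :: int
    by auto
  have n: "2 \<le> n"
    using assms(1) by simp
  show ?thesis
    \<comment> \<open>The shift \<open>d\<close> is pulled out of \<open>min\<close> and
      \<open>max\<close> and cancels in differences; \<open>gamma\<close> then stays folded to match
      the lemmas.\<close>
    unfolding d shift add_diff_cancel_right
    using gamma_co_1[OF mem n] gamma_last[OF mem assms(1)] gamma_co gamma_cbar
    by (simp del: gamma.simps)
qed

end
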